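(* Any Radon curve in a two-dimensional real vector space $V$ is the boundary of a convex body.
   Context: $V$ is a two-dimensional real vector space with origin $o$. A convex body is a compact convex set with interior points. Radon curves. A curve $\gamma\subset V$ is a Radon curve if it arises from the following construction. Take linearly independent $v,w\in V$ and the non-degenerate symplectic bilinear form $[\cdot,\cdot]$ on $V$ with $[v,w]=1$. Let $\gamma_1$ be a curve connecting $v$ and $w$, with $\gamma_1\subseteq\mathrm{conv}\{o,v,w,v+w\}$, such that the union of $\gamma_1$ with the segments from $o$ to $v$ and from $o$ to $w$ is the boundary of a convex body. Let $\gamma_2$ be the curve $$\gamma_2(\lambda)=\frac{(1-\lambda)w+\lambda(-v)}{\sup_{x\in\gamma_1}|[x,(1-\lambda)w+\lambda(-v)]|},\qquad \lambda\in[0,1].$$ Then $\gamma=\gamma_1\cup\gamma_2\cup(-\gamma_1)\cup(-\gamma_2)$. *)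

theory Defs
  imports "HOL-Analysis.Analysis"
begin

definition convex_body :: "'a::real_normed_vector set \<Rightarrow> bool" where
  "convex_body K \<longleftrightarrow> compact K \<and> convex K \<and> interior K \<noteq> {}"

definition symplectic_form :: "('a::real_vector \<Rightarrow> 'a \<Rightarrow> real) \<Rightarrow> bool" where
  "symplectic_form \<omega> \<longleftrightarrow>
     bilinear \<omega> \<and> (\<forall>x. \<omega> x x = 0) \<and> (\<forall>x. x \<noteq> 0 \<longrightarrow> (\<exists>y. \<omega> x y \<noteq> 0))"

definition radon_gamma2 ::
  "('a::real_vector \<Rightarrow> 'a \<Rightarrow> real) \<Rightarrow> 'a \<Rightarrow> 'a \<Rightarrow> 'a set \<Rightarrow> real \<Rightarrow> 'a" where
  "radon_gamma2 \<omega> v w \<gamma>\<^sub>1 t =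
     (let y = (1 - t) *\<^sub>R w + t *\<^sub>R (- v) in y /\<^sub>R (SUP x\<in>\<gamma>\<^sub>1. \<bar>\<omega> x y\<bar>))"

text \<open>
  Curves are identified with their images. The connecting curve is an arc, i.e. it does not
  cross itself: a path that runs back along one of the two segments before tracing the outer
  boundary would satisfy all the other conditions, but its image is not the intended curve.
  The condition \<open>v \<noteq> w\<close> is needed because \<open>independent {v, w}\<close> refers to the set \<open>{v, w}\<close>.
\<close>
definition radon_curve :: "'a::real_normed_vector set \<Rightarrow> bool" where
  "radon_curve \<gamma> \<longleftrightarrow>
     (\<exists>v w \<omega> g \<gamma>\<^sub>1 \<gamma>\<^sub>2.
        v \<noteq> w \<and> independent {v, w} \<and>
        symplectic_form \<omega> \<and> \<omega> v w = 1 \<and>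
        arc g \<and> pathstart g = v \<and> pathfinish g = w \<and> \<gamma>\<^sub>1 = path_image g \<and>
        \<gamma>\<^sub>1 \<subseteq> convex hull {0, v, w, v + w} \<and>
        (\<exists>K. convex_body K \<and> frontier K = \<gamma>\<^sub>1 \<union> closed_segment 0 v \<union> closed_segment 0 w) \<and>
        \<gamma>\<^sub>2 = radon_gamma2 \<omega> v w \<gamma>\<^sub>1 ` {0..1} \<and>
        \<gamma> = \<gamma>\<^sub>1 \<union> \<gamma>\<^sub>2 \<union> uminus ` \<gamma>\<^sub>1 \<union> uminus ` \<gamma>\<^sub>2)"

end

theory Submission imports Defs begin

text \<open>
  In the coordinates given by \<open>v\<close> and \<open>w\<close> the symplectic form is the determinant. Let \<open>G\<close> be
  the arc in the first quadrant, and let \<open>H\<close> be the set of all \<open>z\<close> in the second quadrant with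
  \<open>[x, z] \<le> 1\<close> for all \<open>x \<in> G\<close>; the outer arc of \<open>H\<close> is \<open>\<gamma>\<^sub>2\<close>. The required body is the intersection
  of the strips \<open>\<bar>[x, u]\<bar> \<le> 1\<close> over \<open>x \<in> G \<union> H\<close>, whose frontier consists of the points at
  which one of these inequalities is an equality. In the second quadrant the strips cut out \<open>H\<close>
  by definition; in the first quadrant they cut out the given body by the separation theorem, where
  one uses that this body is closed under decreasing a coordinate. The strips of \<open>G\<close> do not cut
  further into the first quadrant, nor those of \<open>H\<close> into the second, because all points involved
  have coordinates at most 1 in absolute value.
\<close>

section \<open>The determinant form and the strips it defines\<close>

definition det2 :: "real \<times> real \<Rightarrow> real \<times> real \<Rightarrow> real" where
  "det2 x y = fst x * snd y - snd x * fst y"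

lemma det2_commute: "det2 x y = - det2 y x"
  by (simp add: det2_def)

lemma det2_scaleR_right [simp]: "det2 x (c *\<^sub>R y) = c * det2 x y"
  by (simp add: det2_def algebra_simps)

lemma det2_minus_right [simp]: "det2 x (- y) = - det2 x y"
  by (simp add: det2_def)

lemma continuous_on_det2 [continuous_intros]:
  "continuous_on S f \<Longrightarrow> continuous_on S g \<Longrightarrow> continuous_on S (\<lambda>x. det2 (f x) (g x))"
  unfolding det2_def by (intro continuous_intros)

lemma abs_det2_le:
  assumes "\<bar>fst x\<bar> \<le> A" "\<bar>snd x\<bar> \<le> A"
  shows "\<bar>det2 x y\<bar> \<le> 2 * A * norm y"
proof -
  have "\<bar>fst x * snd y\<bar> \<le> A * norm y" "\<bar>snd x * fst y\<bar> \<le> A * norm y"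
    using assms norm_fst_le[of "fst y" "snd y"] norm_snd_le[of "snd y" "fst y"] unfolding abs_mult
    by (auto intro!: mult_mono)
  then show ?thesis
    unfolding det2_def by linarith
qed

text \<open>The absolute polar of \<open>S\<close>, with the determinant in place of an inner
  product.\<close>

definition polar_strip :: "(real \<times> real) set \<Rightarrow> (real \<times> real) set" where
  "polar_strip S = {u. \<forall>x\<in>S. \<bar>det2 x u\<bar> \<le> 1}"

lemma uminus_mem_polar_strip [simp]: "- u \<in> polar_strip S \<longleftrightarrow> u \<in> polar_strip S"
  by (simp add: polar_strip_def)

lemma convex_polar_strip: "convex (polar_strip S)"
proof (rule convexI)
  fix y z and s t :: real
  assume y: "y \<in> polar_strip S" and z: "z \<in> polar_strip S" and st: "0 \<le> s" "0 \<le> t" "s + t = 1"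
  show "s *\<^sub>R y + t *\<^sub>R z \<in> polar_strip S"
    unfolding polar_strip_def
  proof (intro CollectI ballI)
    fix x assume "x \<in> S"
    then have "\<bar>det2 x y\<bar> \<le> 1" "\<bar>det2 x z\<bar> \<le> 1"
      using y z by (auto simp: polar_strip_def)
    then have "s * \<bar>det2 x y\<bar> \<le> s * 1" "t * \<bar>det2 x z\<bar> \<le> t * 1"
      using st by (blast intro: mult_left_mono)+
    moreover have "det2 x (s *\<^sub>R y + t *\<^sub>R z) = s * det2 x y + t * det2 x z"
      by (simp add: det2_def algebra_simps)
    moreover have "\<bar>s * det2 x y + t * det2 x z\<bar> \<le> s * \<bar>det2 x y\<bar> + t * \<bar>det2 x z\<bar>"
      using st by (metis abs_mult abs_of_nonneg abs_triangle_ineq)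
    ultimately show "\<bar>det2 x (s *\<^sub>R y + t *\<^sub>R z)\<bar> \<le> 1"
      using st by linarith
  qed
qed

lemma closed_polar_strip: "closed (polar_strip S)"
proof -
  have "polar_strip S = (\<Inter>x\<in>S. {u. \<bar>det2 x u\<bar> \<le> 1})"
    by (auto simp: polar_strip_def)
  moreover have "closed {u. \<bar>det2 x u\<bar> \<le> 1}" for x
    by (intro closed_Collect_le continuous_intros)
  ultimately show ?thesis
    by auto
qed

text \<open>Compactness of \<open>S\<close> turns the strict inequalities into one common gap, and
  the maps \<open>det2 x\<close> share a Lipschitz constant because \<open>S\<close> is
  bounded.\<close>

lemma interior_polar_stripI:
  assumes "compact S" "\<And>x. x \<in> S \<Longrightarrow> \<bar>det2 x u\<bar> < 1"
  shows "u \<in> interior (polar_strip S)"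
proof (cases "S = {}")
  case True
  then show ?thesis by (simp add: polar_strip_def)
next
  case False
  have "continuous_on S (\<lambda>x. \<bar>det2 x u\<bar>)"
    by (intro continuous_intros)
  then obtain x0 where x0: "x0 \<in> S" "\<And>x. x \<in> S \<Longrightarrow> \<bar>det2 x u\<bar> \<le> \<bar>det2 x0 u\<bar>"
    using continuous_attains_sup[OF assms(1) False] by blast
  define d where "d = 1 - \<bar>det2 x0 u\<bar>"
  have "d > 0"
    using assms(2)[OF x0(1)] by (simp add: d_def)
  obtain A where A: "A > 0" "\<And>x. x \<in> S \<Longrightarrow> norm x \<le> A"
    using compact_imp_bounded[OF assms(1)] by (auto simp: bounded_pos)
  have "ball u (d / (2 * A)) \<subseteq> polar_strip S"
  proof
    fix y assume "y \<in> ball u (d / (2 * A))"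
    then have y: "2 * A * norm (y - u) < d"
      using A(1) by (simp add: dist_norm norm_minus_commute field_simps)
    show "y \<in> polar_strip S"
      unfolding polar_strip_def
    proof (intro CollectI ballI)
      fix x assume x: "x \<in> S"
      have "\<bar>fst x\<bar> \<le> A" "\<bar>snd x\<bar> \<le> A"
        using A(2)[OF x] norm_fst_le[of "fst x" "snd x"] norm_snd_le[of "snd x" "fst x"] by auto
      then have "\<bar>det2 x (y - u)\<bar> < d"
        using abs_det2_le y by (meson le_less_trans)
      moreover have "det2 x y = det2 x u + det2 x (y - u)"
        by (simp add: det2_def algebra_simps)
      ultimately show "\<bar>det2 x y\<bar> \<le> 1"
        using x0(2)[OF x] by (simp add: d_def)
    qed
  qed
  then show ?thesis
    using \<open>d > 0\<close> A(1) by (metis centre_in_ball divide_pos_pos interior_maximal open_ball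
        subset_eq zero_less_mult_iff zero_less_numeral)
qed

lemma interior_scale_up:
  fixes u :: "'a::real_normed_vector"
  assumes "u \<in> interior S"
  obtains c where "c > 1" "c *\<^sub>R u \<in> S"
proof -
  have "((\<lambda>c. c *\<^sub>R u) \<longlongrightarrow> 1 *\<^sub>R u) (at_right (1::real))"
    by (intro tendsto_intros)
  then have "\<forall>\<^sub>F c in at_right (1::real). c *\<^sub>R u \<in> interior S"
    using assms by (intro topological_tendstoD) auto
  moreover have "\<forall>\<^sub>F c in at_right (1::real). c > 1"
    by (simp add: eventually_at_right_less)
  ultimately have "\<forall>\<^sub>F c in at_right (1::real). c > 1 \<and> c *\<^sub>R u \<in> interior S"
    by eventually_elim auto
  then obtain c where "c > 1" "c *\<^sub>R u \<in> interior S"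
    using eventually_happens' trivial_limit_at_right_real by blast
  then show thesis
    using that interior_subset by blast
qed

text \<open>A point with an active inequality leaves the set under every dilation by a factor above
  1; where none is active, all inequalities are strict.\<close>

lemma frontier_polar_strip:
  assumes "compact S"
  shows "frontier (polar_strip S) = {u \<in> polar_strip S. \<exists>x\<in>S. \<bar>det2 x u\<bar> = 1}"
proof -
  have "u \<notin> interior (polar_strip S)" if x: "x \<in> S" "\<bar>det2 x u\<bar> = 1" for x u
  proof
    assume "u \<in> interior (polar_strip S)"
    then obtain c where c: "c > 1" "c *\<^sub>R u \<in> polar_strip S"
      by (rule interior_scale_up)
    then have "\<bar>c * det2 x u\<bar> \<le> 1"
      using x by (auto simp: polar_strip_def)
    then show False
      using c x by (simp add: abs_mult)
  qed
  moreover have "u \<in> interior (polar_strip S)"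
    if "u \<in> polar_strip S" "\<And>x. x \<in> S \<Longrightarrow> \<bar>det2 x u\<bar> \<noteq> 1" for u
    using that by (intro interior_polar_stripI[OF assms]) (force simp: polar_strip_def order_less_le)
  ultimately show ?thesis
    unfolding frontier_def closure_closed[OF closed_polar_strip] by blast
qed

section \<open>The unit square, and the conjugate curve in coordinates\<close>

lemma mult_unit_interval:
  fixes a b :: real
  assumes "0 \<le> a" "a \<le> 1" "0 \<le> b" "b \<le> 1"
  shows "0 \<le> a * b" "a * b \<le> a" "a * b \<le> b"
  using assms by (simp_all add: mult_left_le mult_right_le_one_le mult_left_le_one_le)

text \<open>The determinant is a difference of two nonnegative products, at most
  \<open>snd y\<close> and \<open>fst y\<close> respectively; absolute value 1 forces one of these
  to be 1.\<close>

lemma abs_det2_le_1: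
  fixes x y :: "real \<times> real"
  assumes "x \<in> {0..1} \<times> {0..1}" "y \<in> {0..1} \<times> {0..1}"
  shows "\<bar>det2 x y\<bar> \<le> 1"
    and "\<bar>det2 x y\<bar> = 1 \<Longrightarrow> fst y = 1 \<or> snd y = 1"
proof -
  have "0 \<le> fst x * snd y" "fst x * snd y \<le> snd y" "snd y \<le> 1"
    "0 \<le> snd x * fst y" "snd x * fst y \<le> fst y" "fst y \<le> 1"
    using assms mult_unit_interval[of "fst x" "snd y"] mult_unit_interval[of "snd x" "fst y"]
    unfolding mem_Times_iff atLeastAtMost_iff by simp_all
  then show "\<bar>det2 x y\<bar> \<le> 1" "\<bar>det2 x y\<bar> = 1 \<Longrightarrow> fst y = 1 \<or> snd y = 1"
    unfolding det2_def by linarith+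
qed

text \<open>The set \<open>H\<close> described at the start. For \<open>G\<close> in the first
  quadrant \<open>det2 x z\<close> is nonnegative here, so the one-sided inequality is the strip
  condition.\<close>

definition conj_region :: "(real \<times> real) set \<Rightarrow> (real \<times> real) set" where
  "conj_region G = {z. fst z \<le> 0 \<and> 0 \<le> snd z \<and> (\<forall>x\<in>G. det2 x z \<le> 1)}"

text \<open>Every ray of the closed second quadrant meets the segment from \<open>(0, 1)\<close> to
  \<open>(- 1, 0)\<close>; dividing by the supremum rescales that point until the largest
  \<open>det2 x z\<close> over \<open>G\<close> is exactly 1.\<close>

lemma radon_gamma2_image:
  assumes G: "compact G" "\<And>x. x \<in> G \<Longrightarrow> 0 \<le> fst x \<and> 0 \<le> snd x"
    and e: "(1, 0) \<in> G" "(0, 1) \<in> G"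
  shows "radon_gamma2 det2 (1, 0) (0, 1) G ` {0..1} = {z \<in> conj_region G. \<exists>x\<in>G. det2 x z = 1}"
    (is "?L = ?R")
proof -
  let ?y = "\<lambda>t::real. (1 - t) *\<^sub>R (0, 1) + t *\<^sub>R (- (1, 0)) :: real \<times> real"
  have y: "?y t = (- t, 1 - t)" for t
    by simp
  have nonneg: "0 \<le> det2 x (- t, 1 - t)" if "x \<in> G" "t \<in> {0..1}" for x t
    using G(2)[OF that(1)] that(2) by (auto simp: det2_def)
  have eval: "radon_gamma2 det2 (1, 0) (0, 1) G t = (- t, 1 - t) /\<^sub>R det2 x (- t, 1 - t)"
    if t: "t \<in> {0..1}" and x: "x \<in> G" "\<And>x'. x' \<in> G \<Longrightarrow> det2 x' (- t, 1 - t) \<le> det2 x (- t, 1 - t)"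
    for t x
  proof -
    have "(SUP x\<in>G. \<bar>det2 x (- t, 1 - t)\<bar>) = (SUP x\<in>G. det2 x (- t, 1 - t))"
      by (intro SUP_cong) (use nonneg t in auto)
    also have "\<dots> = det2 x (- t, 1 - t)"
      by (rule cSup_eq_maximum) (use x in auto)
    finally have "(SUP x\<in>G. \<bar>det2 x (- t, 1 - t)\<bar>) = det2 x (- t, 1 - t)" .
    then show ?thesis
      unfolding radon_gamma2_def Let_def y by simp
  qed
  show ?thesis
  proof (intro equalityI subsetI)
    fix z assume "z \<in> ?L"
    then obtain t where t: "t \<in> {0..1}" "z = radon_gamma2 det2 (1, 0) (0, 1) G t"
      by blast
    have "continuous_on G (\<lambda>x. det2 x (- t, 1 - t))"
      by (intro continuous_intros)
    then obtain x where x: "x \<in> G" "\<And>x'. x' \<in> G \<Longrightarrow> det2 x' (- t, 1 - t) \<le> det2 x (- t, 1 - t)"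
      using continuous_attains_sup[OF G(1)] e by blast
    define m where "m = det2 x (- t, 1 - t)"
    \<comment> \<open>The ends of the arc bound the maximum below by \<open>1 - t\<close> and
      \<open>t\<close>, which add up to 1, so it is positive.\<close>
    have "1 - t \<le> m" "t \<le> m"
      using x(2)[OF e(1)] x(2)[OF e(2)] by (auto simp: det2_def m_def)
    then have m: "m > 0"
      by linarith
    have z: "z = (1 / m) *\<^sub>R (- t, 1 - t)"
      using eval[OF t(1) x] t(2) by (simp add: m_def inverse_eq_divide)
    have "det2 x' z \<le> 1" if "x' \<in> G" for x'
      using x(2)[OF that] m unfolding z det2_scaleR_right m_def by simp
    moreover have "det2 x z = 1"
      using m unfolding z det2_scaleR_right m_def by simp
    moreover have "fst z \<le> 0" "0 \<le> snd z"
      using m t(1) unfolding z by auto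
    ultimately show "z \<in> ?R"
      using x(1) by (auto simp: conj_region_def)
  next
    fix z assume "z \<in> ?R"
    then obtain x where x: "x \<in> G" "det2 x z = 1"
      and z: "fst z \<le> 0" "0 \<le> snd z" "\<And>x. x \<in> G \<Longrightarrow> det2 x z \<le> 1"
      by (auto simp: conj_region_def)
    \<comment> \<open>Dividing \<open>z\<close> by the sum \<open>s\<close> of its absolute
      coordinates puts it on the segment, at the parameter \<open>t\<close> below.\<close>
    define s where "s = snd z - fst z"
    have "s \<noteq> 0"
    proof
      assume "s = 0"
      then have "fst z = 0" "snd z = 0"
        using z by (auto simp: s_def)
      then show False
        using x by (simp add: det2_def)
    qed
    then have s: "s > 0"
      using z by (auto simp: s_def)
    define t where "t = - fst z / s"
    have t: "t \<in> {0..1}"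
      using z s by (auto simp: t_def field_simps s_def)
    have ty: "(- t, 1 - t) = (1 / s) *\<^sub>R z"
      using s by (auto simp: t_def prod_eq_iff field_simps s_def)
    have "radon_gamma2 det2 (1, 0) (0, 1) G t = (- t, 1 - t) /\<^sub>R det2 x (- t, 1 - t)"
      by (rule eval[OF t x(1)]) (use x z s in \<open>simp add: ty divide_right_mono\<close>)
    also have "\<dots> = z"
      unfolding ty det2_scaleR_right x(2) using s by simp
    finally show "z \<in> ?L"
      using t by (metis imageI)
  qed
qed

section \<open>Connected subsets of arcs, and maximizers of linear functionals\<close>

lemma arc_image_unique:
  fixes g :: "real \<Rightarrow> 'a::t2_space"
  assumes g: "arc g" and P: "connected P" "P \<subseteq> path_image g" "pathstart g \<in> P" "pathfinish g \<in> P"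
  shows "P = path_image g"
proof -
  obtain h where h: "homeomorphism {0..1} (path_image g) g h"
    using homeomorphism_arc[OF g] .
  \<comment> \<open>The inverse \<open>h\<close> carries \<open>P\<close> to a connected set of
    parameters containing 0 and 1, hence to the whole interval.\<close>
  have "connected (h ` P)"
    using h P by (meson connected_continuous_image continuous_on_subset homeomorphism_cont2)
  moreover have "h (g 0) = 0" "h (g 1) = 1"
    using h by (auto simp: homeomorphism_def)
  then have "0 \<in> h ` P" "1 \<in> h ` P"
    using P by (force simp: pathstart_def pathfinish_def)+
  ultimately have "{0..1} \<subseteq> h ` P"
    using connected_contains_Icc by blast
  moreover have "g (h x) = x" if "x \<in> P" for x
    using that P(2) h by (auto simp: homeomorphism_def)
  ultimately have "path_image g \<subseteq> P"
    unfolding path_image_def by force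
  then show ?thesis
    using P by blast
qed

lemma mem_interior_not_dot_max:
  fixes c :: "'a::real_inner"
  assumes "u \<in> interior K" "c \<noteq> 0" "\<And>y. y \<in> K \<Longrightarrow> c \<bullet> y \<le> c \<bullet> u"
  shows False
proof -
  obtain e where e: "e > 0" "ball u e \<subseteq> K"
    using assms(1) by (meson mem_interior)
  \<comment> \<open>A step of length \<open>e / 2\<close> along \<open>c\<close> stays in the ball
    and strictly increases the functional.\<close>
  define y where "y = u + (e / 2 / norm c) *\<^sub>R c"
  have "y \<in> ball u e"
    using e(1) assms(2) by (simp add: y_def dist_norm)
  then have "c \<bullet> y \<le> c \<bullet> u"
    using e(2) assms(3) by blast
  moreover have "c \<bullet> y = c \<bullet> u + (e / 2 / norm c) * (c \<bullet> c)"
    by (simp add: y_def inner_add_right)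
  moreover have "(e / 2 / norm c) * (c \<bullet> c) > 0"
    using e(1) assms(2) by simp
  ultimately show False
    by linarith
qed

lemma det2_eq_inner: "det2 x y = (snd y, - fst y) \<bullet> x"
  by (simp add: det2_def inner_prod_def)

section \<open>The given body in the unit square\<close>

locale corner_body =
  fixes K G :: "(real \<times> real) set"
  assumes convex_K: "convex K" and compact_K: "compact K" and interior_K: "interior K \<noteq> {}"
    and compact_G: "compact G"
    and G_square: "x \<in> G \<Longrightarrow> 0 \<le> fst x \<and> fst x \<le> 1 \<and> 0 \<le> snd x \<and> snd x \<le> 1"
    and e1: "(1, 0) \<in> G" and e2: "(0, 1) \<in> G"
    and frontier_K: "frontier K = G \<union> closed_segment 0 (1, 0) \<union> closed_segment 0 (0, 1)"
begin

lemma frontier_subset_K: "frontier K \<subseteq> K"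
  by (simp add: compact_K compact_imp_closed frontier_subset_closed)

lemma K_hull: "K = convex hull (frontier K)"
  by (rule Krein_Milman_frontier[OF convex_K compact_K])

lemma G_subset_K: "x \<in> G \<Longrightarrow> x \<in> K"
  using frontier_K frontier_subset_K by blast

text \<open>\<open>K\<close> is the convex hull of its frontier, and the two segments lie in the
  hull of \<open>0\<close> and the ends of the arc.\<close>

lemma K_induct:
  assumes x: "x \<in> K" and P: "convex {x. P x}" "P 0" "\<And>x. x \<in> G \<Longrightarrow> P x"
  shows "P x"
proof -
  have "closed_segment 0 (1, 0) \<subseteq> {x. P x}" "closed_segment 0 (0, 1) \<subseteq> {x. P x}"
    by (rule closed_segment_subset; use P e1 e2 in simp)+
  then have "frontier K \<subseteq> {x. P x}"
    using P frontier_K by auto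
  then have "K \<subseteq> {x. P x}"
    using K_hull P(1) by (metis hull_minimal)
  then show ?thesis
    using x by blast
qed

lemma K_square:
  assumes "x \<in> K"
  shows "0 \<le> fst x \<and> fst x \<le> 1 \<and> 0 \<le> snd x \<and> snd x \<le> 1"
proof (rule K_induct[OF assms])
  have "{x :: real \<times> real. 0 \<le> fst x \<and> fst x \<le> 1 \<and> 0 \<le> snd x \<and> snd x \<le> 1} = {0..1} \<times> {0..1}"
    by auto
  then show "convex {x :: real \<times> real. 0 \<le> fst x \<and> fst x \<le> 1 \<and> 0 \<le> snd x \<and> snd x \<le> 1}"
    by (simp add: convex_Times)
qed (auto dest: G_square)

text \<open>The defining inequality of \<open>conj_region G\<close> describes a half-plane
  containing \<open>0\<close>, so it spreads from \<open>G\<close> to \<open>K\<close>.\<close>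

lemma K_det2_le:
  assumes "x \<in> K" "z \<in> conj_region G"
  shows "det2 x z \<le> 1"
proof (rule K_induct[OF assms(1)])
  show "convex {x. det2 x z \<le> 1}"
    unfolding det2_eq_inner by (rule convex_halfspace_le)
qed (use assms(2) in \<open>auto simp: det2_def conj_region_def\<close>)

lemma segments_subset_K:
  assumes "0 \<le> t" "t \<le> 1"
  shows "(t, 0) \<in> K" "(0, t) \<in> K" "(t, 1 - t) \<in> K"
proof -
  have "0 \<in> K"
    using frontier_K frontier_subset_K by auto
  then have "(1 - t) *\<^sub>R 0 + t *\<^sub>R (1, 0) \<in> K" "(1 - t) *\<^sub>R 0 + t *\<^sub>R (0, 1) \<in> K"
    "(1 - t) *\<^sub>R (0, 1) + t *\<^sub>R (1, 0) \<in> K"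
    using assms G_subset_K[OF e1] G_subset_K[OF e2] by (intro convexD_alt[OF convex_K]; simp)+
  then show "(t, 0) \<in> K" "(0, t) \<in> K" "(t, 1 - t) \<in> K"
    by simp_all
qed

lemma conj_region_square:
  assumes "z \<in> conj_region G"
  shows "-1 \<le> fst z \<and> fst z \<le> 0 \<and> 0 \<le> snd z \<and> snd z \<le> 1"
  using assms e1 e2 unfolding conj_region_def det2_def by force

lemma compact_conj_region: "compact (conj_region G)"
proof -
  have eq: "conj_region G = {z. fst z \<le> 0} \<inter> {z. 0 \<le> snd z} \<inter> (\<Inter>x\<in>G. {z. det2 x z \<le> 1})"
    by (auto simp: conj_region_def)
  have "closed (conj_region G)"
    unfolding eq by (intro closed_Int closed_INT ballI closed_Collect_le continuous_intros)
  moreover have "conj_region G \<subseteq> {-1..0} \<times> {0..1}"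
    using conj_region_square by (force simp: mem_Times_iff)
  then have "bounded (conj_region G)"
    by (rule bounded_subset[rotated]) (simp add: bounded_Times)
  ultimately show ?thesis
    by (simp add: compact_eq_bounded_closed)
qed

text \<open>Pushing a point of the open triangle onto the line through \<open>(1, 0)\<close> and \<open>(0, 1)\<close>
  along an axis decreases its distance to a point whose coordinate on that axis is at least 1.\<close>

lemma closest_point_above_diagonal:
  assumes "1 \<le> fst a \<or> 1 \<le> snd a"
  shows "1 \<le> fst (closest_point K a) + snd (closest_point K a)"
proof (rule ccontr)
  define z where "z = closest_point K a"
  assume "\<not> ?thesis"
  then have lt: "fst z + snd z < 1"
    by (simp add: z_def)
  have "z \<in> K"
    using closest_point_in_set[of K a] compact_K e1 G_subset_K
    by (auto simp: z_def compact_imp_closed)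
  then have z: "0 \<le> fst z" "fst z \<le> 1" "0 \<le> snd z" "snd z \<le> 1"
    using K_square by auto
  have le: "(a - z) \<bullet> (y - z) \<le> 0" if "y \<in> K" for y
    using closest_point_dot[OF convex_K compact_imp_closed[OF compact_K] that] by (simp add: z_def)
  have "(fst a - fst z) * (1 - snd z - fst z) \<le> 0"
    using le[OF segments_subset_K(3)[of "1 - snd z"]] z by (simp add: inner_prod_def)
  moreover have "(snd a - snd z) * (1 - fst z - snd z) \<le> 0"
    using le[OF segments_subset_K(3)[of "fst z"]] z by (simp add: inner_prod_def)
  ultimately have "fst a \<le> fst z" "snd a \<le> snd z"
    using lt by (auto simp: mult_le_0_iff)
  then show False
    using assms lt z by linarith
qed

end

section \<open>The arc as the outer part of the frontier\<close>

locale corner_arc = corner_body K "path_image g" for K g +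
  assumes arc_g: "arc g" and start_g: "pathstart g = (1, 0)" and finish_g: "pathfinish g = (0, 1)"
begin

abbreviation "G \<equiv> path_image g"

text \<open>The closest point map sends the segment from \<open>(2, 0)\<close> to \<open>(0, 2)\<close> to a connected part of
  the frontier that misses the interiors of the two segments, hence to a connected subset of the
  arc containing both ends.\<close>

lemma G_eq: "G = {x \<in> frontier K. 1 \<le> fst x + snd x}"
proof -
  define B :: "(real \<times> real) set" where "B = closed_segment (2, 0) (0, 2)"
  define P where "P = closest_point K ` B"
  have ne: "K \<noteq> {}" and cl: "closed K"
    using e1 G_subset_K compact_K by (auto simp: compact_imp_closed)
  have B: "fst a + snd a = 2" if "a \<in> B" for a
    using that by (auto simp: B_def closed_segment_def algebra_simps)
  \<comment> \<open>The two segments reach coordinate sum 1 only at \<open>(1, 0)\<close> and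
    \<open>(0, 1)\<close>, which belong to the arc.\<close>
  have touch: "x \<in> G" if "x \<in> frontier K" "1 \<le> fst x + snd x" for x
    using that e1 e2 unfolding frontier_K by (auto simp: closed_segment_def)
  have P_sub: "x \<in> frontier K \<and> 1 \<le> fst x + snd x" if "x \<in> P" for x
  proof -
    obtain a where a: "a \<in> B" "x = closest_point K a"
      using \<open>x \<in> P\<close> by (auto simp: P_def)
    have above: "1 \<le> fst x + snd x"
      unfolding a using B[OF a(1)] by (intro closest_point_above_diagonal) linarith
    have "x \<in> K"
      using a closest_point_in_set[OF cl ne] by blast
    moreover have "x \<notin> interior K"
    proof
      assume x: "x \<in> interior K"
      \<comment> \<open>This makes the normal \<open>a - x\<close> nonzero. A common point would
        have coordinate sum 2 in the square, so be \<open>(1, 1)\<close>, which cannot be interior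
        to \<open>K\<close>.\<close>
      have "a \<noteq> x"
      proof
        assume "a = x"
        then have "x = (1, 1)"
          using K_square[OF \<open>x \<in> K\<close>] B[OF a(1)] by (simp add: prod_eq_iff)
        then obtain c where "c > 1" "c *\<^sub>R (1, 1) \<in> K"
          using interior_scale_up x by metis
        then show False
          using K_square by fastforce
      qed
      moreover have "(a - x) \<bullet> y \<le> (a - x) \<bullet> x" if "y \<in> K" for y
        using closest_point_dot[OF convex_K cl that, of a] unfolding a(2)
        by (simp add: inner_diff_right)
      ultimately show False
        using mem_interior_not_dot_max[OF x, of "a - x"] by simp
    qed
    ultimately show ?thesis
      using above closure_subset by (auto simp: frontier_def)
  qed
  have "connected P"
    unfolding P_def B_def
    by (intro connected_continuous_image continuous_on_closest_point convex_K cl ne) simp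
  moreover have "P \<subseteq> G"
    using P_sub touch by blast
  \<comment> \<open>\<open>K\<close> has first coordinates at most 1, so its distance from
    \<open>(2, 0)\<close> is at least 1. Thus the ends of \<open>B\<close> are sent to the ends of
    the arc.\<close>
  moreover have "(1, 0) = closest_point K (2, 0)"
  proof (rule closest_point_unique[OF convex_K cl])
    show "\<forall>z\<in>K. dist (2, 0::real) (1::real, 0) \<le> dist (2, 0) z"
    proof
      fix z assume "z \<in> K"
      then have "1 \<le> dist 2 (fst z)"
        using K_square by (fastforce simp: dist_real_def)
      also have "\<dots> \<le> dist (2, 0) z"
        using dist_fst_le[of "(2, 0)" z] by simp
      finally show "dist (2, 0::real) (1::real, 0) \<le> dist (2, 0) z"
        by (simp add: dist_Pair_Pair dist_real_def)
    qed
  qed (use e1 G_subset_K in auto)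
  then have "pathstart g \<in> P"
    unfolding start_g P_def B_def by (metis ends_in_segment(1) imageI)
  moreover have "(0, 1) = closest_point K (0, 2)"
  proof (rule closest_point_unique[OF convex_K cl])
    show "\<forall>z\<in>K. dist (0::real, 2) (0, 1::real) \<le> dist (0, 2) z"
    proof
      fix z assume "z \<in> K"
      then have "1 \<le> dist 2 (snd z)"
        using K_square by (fastforce simp: dist_real_def)
      also have "\<dots> \<le> dist (0, 2) z"
        using dist_snd_le[of "(0, 2)" z] by simp
      finally show "dist (0::real, 2) (0, 1::real) \<le> dist (0, 2) z"
        by (simp add: dist_Pair_Pair dist_real_def)
    qed
  qed (use e2 G_subset_K in auto)
  then have "pathfinish g \<in> P"
    unfolding finish_g P_def B_def by (metis ends_in_segment(2) imageI)
  ultimately have "P = G"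
    using arc_image_unique[OF arc_g] by blast
  then show ?thesis
    using P_sub touch by blast
qed

section \<open>The symmetric body and its frontier\<close>

definition "Conj_arc = {z \<in> conj_region G. \<exists>x\<in>G. det2 x z = 1}"

definition "radon_body = polar_strip (G \<union> conj_region G)"

text \<open>Polarity: a supporting line of \<open>K\<close> with inner normal \<open>a\<close> in
  the third quadrant becomes a point of the conjugate arc, namely \<open>a\<close> turned by a right
  angle and divided by \<open>m\<close>.\<close>

lemma Conj_arc_supporting:
  assumes a: "fst a \<le> 0" "snd a \<le> 0" "a \<noteq> 0"
  obtains m z where "m > 0" "z \<in> Conj_arc" "\<And>x. det2 z x = (a \<bullet> x) / m"
    "\<exists>x\<in>G. a \<bullet> x = - m" "\<And>x. x \<in> K \<Longrightarrow> - m \<le> a \<bullet> x"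
proof -
  have "continuous_on G (\<lambda>x. a \<bullet> x)"
    by (intro continuous_intros)
  then obtain x where x: "x \<in> G" "\<And>x'. x' \<in> G \<Longrightarrow> a \<bullet> x \<le> a \<bullet> x'"
    using continuous_attains_inf[OF compact_G] e1 by blast
  define m where "m = - (a \<bullet> x)"
  define z where "z = (1 / m) *\<^sub>R (snd a, - fst a)"
  \<comment> \<open>Comparing the minimum with the values at the ends of the arc gives
    \<open>m > 0\<close>, since \<open>a\<close> is nonzero with nonpositive coordinates.\<close>
  have "- fst a \<le> m" "- snd a \<le> m"
    using x(2)[OF e1] x(2)[OF e2] by (auto simp: m_def inner_prod_def)
  then have m: "m > 0"
    using a by (auto simp: prod_eq_iff)
  have det: "det2 z y = (a \<bullet> y) / m" for y
    by (simp add: z_def det2_def inner_prod_def add_divide_distrib)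
  then have det': "det2 y z = - (a \<bullet> y) / m" for y
    by (simp add: det2_commute[of y z])
  have region: "z \<in> conj_region G"
    unfolding conj_region_def mem_Collect_eq det' using m a x(2)
    by (auto simp: m_def z_def divide_nonpos_neg)
  then have "z \<in> Conj_arc"
    unfolding Conj_arc_def mem_Collect_eq det' using m x(1) by (auto simp: m_def)
  moreover have "- m \<le> a \<bullet> y" if "y \<in> K" for y
    using K_det2_le[OF that region] m unfolding det' by (simp add: field_simps)
  moreover have "\<exists>x\<in>G. a \<bullet> x = - m"
    using x(1) by (auto simp: m_def)
  ultimately show thesis
    using that m det by blast
qed

lemma conj_square:
  assumes "x \<in> conj_region G"
  shows "(- fst x, snd x) \<in> {0..1} \<times> {0..1}"
  using conj_region_square[OF assms] by auto

text \<open>This reflection takes \<open>conj_region G\<close> into the unit square, so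
  \<open>abs_det2_le_1\<close> becomes available for pairs of points there.\<close>

lemma det2_reflect: "det2 (- fst x, snd x) (- fst y, snd y) = - det2 x y"
  by (simp add: det2_def)

lemma det2_nonneg:
  assumes "x \<in> K" "z \<in> conj_region G"
  shows "0 \<le> det2 x z"
proof -
  have "0 \<le> fst x * snd z" "0 \<le> snd x * (- fst z)"
    using K_square[OF assms(1)] conj_region_square[OF assms(2)] by (intro mult_nonneg_nonneg; linarith)+
  then show ?thesis
    by (simp add: det2_def)
qed

lemma abs_det2_mixed:
  assumes "x \<in> K" "z \<in> conj_region G"
  shows "\<bar>det2 x z\<bar> \<le> 1" "\<bar>det2 z x\<bar> \<le> 1" "\<bar>det2 z x\<bar> = det2 x z"
  using det2_nonneg[OF assms] K_det2_le[OF assms] det2_commute[of z x] by auto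

text \<open>If a coordinate of \<open>u\<close> is 1, the strip of an end of the arc is active.
  Otherwise polarity turns a supporting line of \<open>K\<close> at \<open>u\<close> into an active
  strip.\<close>

lemma G_touching:
  assumes u: "u \<in> G"
  shows "u \<in> radon_body" "\<exists>x\<in>G \<union> conj_region G. \<bar>det2 x u\<bar> = 1"
proof -
  have sq: "x \<in> {0..1} \<times> {0..1}" if "x \<in> G" for x
    using G_square[OF that] by (simp add: mem_Times_iff)
  show "u \<in> radon_body"
    unfolding radon_body_def polar_strip_def
    using abs_det2_le_1(1)[OF sq sq[OF u]] abs_det2_mixed(2)[OF G_subset_K[OF u]] by blast
  show "\<exists>x\<in>G \<union> conj_region G. \<bar>det2 x u\<bar> = 1"
  proof (cases "fst u = 1 \<or> snd u = 1")
    case True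
    then have "\<bar>det2 (0, 1) u\<bar> = 1 \<or> \<bar>det2 (1, 0) u\<bar> = 1"
      by (auto simp: det2_def)
    then show ?thesis
      using e1 e2 by blast
  next
    case False
    then have pos: "0 < fst u" "0 < snd u"
      using u G_square[OF u] G_eq by auto
    have "u \<in> K" and "u \<notin> rel_interior K"
      using u G_eq G_subset_K interior_K by (auto simp: frontier_def rel_interior_nonempty_interior)
    then obtain a where a: "a \<noteq> 0" "\<And>y. y \<in> K \<Longrightarrow> a \<bullet> u \<le> a \<bullet> y"
      using supporting_hyperplane_rel_boundary[OF convex_K] by metis
    \<comment> \<open>The projections \<open>(0, snd u)\<close> and \<open>(fst u, 0)\<close> lie in
      \<open>K\<close>; comparing \<open>u\<close> with them forces the normal into the third
      quadrant.\<close>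
    have "fst a * fst u \<le> 0" "snd a * snd u \<le> 0"
      using a(2)[OF segments_subset_K(2)[of "snd u"]] a(2)[OF segments_subset_K(1)[of "fst u"]]
        G_square[OF u] by (auto simp: inner_prod_def)
    then have "fst a \<le> 0" "snd a \<le> 0"
      using pos by (auto simp: mult_le_0_iff)
    then obtain m z where m: "m > 0" "z \<in> Conj_arc" "\<And>x. det2 z x = (a \<bullet> x) / m"
      "\<exists>x\<in>G. a \<bullet> x = - m" "\<And>x. x \<in> K \<Longrightarrow> - m \<le> a \<bullet> x"
      using Conj_arc_supporting a(1) by metis
    then obtain x where "x \<in> G" "a \<bullet> x = - m"
      by blast
    then have "a \<bullet> u = - m"
      using m(5)[OF \<open>u \<in> K\<close>] a(2)[of x] G_subset_K by fastforce
    then have "\<bar>det2 z u\<bar> = 1"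
      using m(1) by (simp add: m(3))
    then show ?thesis
      using m(2) by (auto simp: Conj_arc_def)
  qed
qed

lemma Conj_arc_touching:
  assumes u: "u \<in> Conj_arc"
  shows "u \<in> radon_body" "\<exists>x\<in>G \<union> conj_region G. \<bar>det2 x u\<bar> = 1"
proof -
  have u': "u \<in> conj_region G"
    using u by (simp add: Conj_arc_def)
  have "\<bar>det2 x u\<bar> \<le> 1" if "x \<in> conj_region G" for x
    using abs_det2_le_1(1)[OF conj_square[OF that] conj_square[OF u']] by (simp add: det2_reflect)
  then show "u \<in> radon_body"
    unfolding radon_body_def polar_strip_def
    using abs_det2_mixed(1)[OF G_subset_K u'] by blast
  show "\<exists>x\<in>G \<union> conj_region G. \<bar>det2 x u\<bar> = 1"
    using u by (force simp: Conj_arc_def)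
qed

lemma radon_body_square:
  assumes "u \<in> radon_body"
  shows "\<bar>fst u\<bar> \<le> 1" "\<bar>snd u\<bar> \<le> 1"
  using assms e1 e2 unfolding radon_body_def polar_strip_def det2_def by force+

text \<open>By polarity, a line separating \<open>u\<close> from \<open>K\<close> would yield a
  point of the conjugate arc whose strip excludes \<open>u\<close>.\<close>

lemma radon_body_first_quadrant:
  assumes u: "u \<in> radon_body" "0 \<le> fst u" "0 \<le> snd u"
  shows "u \<in> K"
proof (rule ccontr)
  assume "u \<notin> K"
  then obtain a b where a: "a \<bullet> u < b" "\<And>x. x \<in> K \<Longrightarrow> b < a \<bullet> x"
    using separating_hyperplane_closed_point[OF convex_K compact_imp_closed[OF compact_K]] by metis
  \<comment> \<open>The projections of \<open>u\<close> to the axes lie in \<open>K\<close>, hence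
    beyond the separating line; this makes both coordinates of \<open>a\<close> negative.\<close>
  have "a \<bullet> u < a \<bullet> (0, snd u)" "a \<bullet> u < a \<bullet> (fst u, 0)"
    using a(1) a(2)[OF segments_subset_K(2)[of "snd u"]] a(2)[OF segments_subset_K(1)[of "fst u"]]
      radon_body_square[OF u(1)] u by auto
  then have "fst a * fst u < 0" "snd a * snd u < 0"
    by (auto simp: inner_prod_def)
  then have "fst a < 0" "snd a < 0"
    using u by (auto simp: mult_less_0_iff)
  then have "fst a \<le> 0" "snd a \<le> 0" "a \<noteq> 0"
    by auto
  then obtain m z where m: "m > 0" "z \<in> Conj_arc" "\<And>x. det2 z x = (a \<bullet> x) / m"
    "\<exists>x\<in>G. a \<bullet> x = - m"
    by (metis Conj_arc_supporting)
  then obtain x where "x \<in> G" "a \<bullet> x = - m"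
    by blast
  then have "a \<bullet> u < - m"
    using a(1) a(2)[of x] G_subset_K by fastforce
  then have "det2 z u < -1"
    using m(1) by (simp add: m(3) field_simps)
  moreover have "\<bar>det2 z u\<bar> \<le> 1"
    using u(1) m(2) by (auto simp: radon_body_def polar_strip_def Conj_arc_def)
  ultimately show False
    by linarith
qed

text \<open>An active strip gives a line through \<open>u\<close> with \<open>K\<close> on one side,
  so \<open>u\<close> is a frontier point; with coordinate sum at least 1, \<open>G_eq\<close> puts
  it on the arc.\<close>

lemma touching_first_quadrant:
  assumes u: "u \<in> radon_body" "0 \<le> fst u" "0 \<le> snd u"
    and x: "x \<in> G \<union> conj_region G" "\<bar>det2 x u\<bar> = 1"
  shows "u \<in> G"
proof -
  have uK: "u \<in> K"
    by (rule radon_body_first_quadrant[OF u])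
  have sq: "u \<in> {0..1} \<times> {0..1}"
    using K_square[OF uK] by (simp add: mem_Times_iff)
  obtain c where c: "c \<noteq> 0" "\<And>y. y \<in> K \<Longrightarrow> c \<bullet> y \<le> c \<bullet> u" and sum: "1 \<le> fst u + snd u"
  proof (cases "x \<in> G")
    case True
    then have "x \<in> {0..1} \<times> {0..1}"
      using G_square by (simp add: mem_Times_iff)
    then consider "fst u = 1" | "snd u = 1"
      using abs_det2_le_1(2)[OF _ sq x(2)] by blast
    then show thesis
    proof cases
      case 1
      then show thesis
        by (intro that[of "(1, 0)"]) (use K_square u in \<open>auto simp: inner_prod_def zero_prod_def\<close>)
    next
      case 2
      then show thesis
        by (intro that[of "(0, 1)"]) (use K_square u in \<open>auto simp: inner_prod_def zero_prod_def\<close>)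
    qed
  next
    case False
    then have z: "x \<in> conj_region G"
      using x by blast
    then have 1: "(snd x, - fst x) \<bullet> u = 1"
      using abs_det2_mixed(3)[OF uK] x(2) det2_eq_inner by metis
    have "(snd x, - fst x) \<bullet> y \<le> (snd x, - fst x) \<bullet> u" if "y \<in> K" for y
      unfolding 1 using K_det2_le[OF that z] by (simp add: det2_eq_inner)
    moreover have "(snd x, - fst x) \<noteq> 0"
      using 1 by auto
    \<comment> \<open>The coefficients of the functional are at most 1, so its value 1 at
      \<open>u\<close> bounds the coordinate sum from below.\<close>
    moreover have "snd x * fst u \<le> fst u" "- fst x * snd u \<le> snd u"
      using mult_unit_interval(3)[of "snd x" "fst u"] mult_unit_interval(3)[of "- fst x" "snd u"]
        conj_region_square[OF z] K_square[OF uK] by auto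
    then have "1 \<le> fst u + snd u"
      using 1 by (simp add: inner_prod_def)
    ultimately show thesis
      using that by blast
  qed
  have "u \<notin> interior K"
    using mem_interior_not_dot_max c by blast
  then show ?thesis
    using sum uK closure_subset unfolding G_eq frontier_def by blast
qed

text \<open>If the active strip comes from \<open>conj_region G\<close>, reflection into the square
  forces a coordinate of absolute value 1, and then the strip of an end of the arc is active
  too.\<close>

lemma touching_second_quadrant:
  assumes u: "u \<in> radon_body" "fst u \<le> 0" "0 \<le> snd u"
    and x: "x \<in> G \<union> conj_region G" "\<bar>det2 x u\<bar> = 1"
  shows "u \<in> Conj_arc"
proof -
  have u': "u \<in> conj_region G"
    using u unfolding conj_region_def radon_body_def polar_strip_def by force
  have "\<exists>x\<in>G. \<bar>det2 x u\<bar> = 1"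
  proof (cases "x \<in> G")
    case True
    then show ?thesis using x by blast
  next
    case False
    then have "(- fst x, snd x) \<in> {0..1} \<times> {0..1}"
      using x conj_square by blast
    moreover have "\<bar>det2 (- fst x, snd x) (- fst u, snd u)\<bar> = 1"
      using x(2) by (simp add: det2_reflect)
    ultimately have "- fst u = 1 \<or> snd u = 1"
      using abs_det2_le_1(2)[OF _ conj_square[OF u']] by fastforce
    then have "\<bar>det2 (0, 1) u\<bar> = 1 \<or> \<bar>det2 (1, 0) u\<bar> = 1"
      by (auto simp: det2_def)
    then show ?thesis
      using e1 e2 by blast
  qed
  then show ?thesis
    using u' det2_nonneg[OF G_subset_K u'] unfolding Conj_arc_def by force
qed

lemma compact_conj_data: "compact (G \<union> conj_region G)"
  using compact_G compact_conj_region by (rule compact_Un)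

text \<open>The two quadrants with \<open>0 \<le> snd u\<close> are settled by the touching lemmas,
  the others by central symmetry.\<close>

lemma frontier_radon_body:
  "frontier radon_body = G \<union> Conj_arc \<union> uminus ` G \<union> uminus ` Conj_arc"
proof -
  let ?F = "{u \<in> radon_body. \<exists>x\<in>G \<union> conj_region G. \<bar>det2 x u\<bar> = 1}"
  have F: "frontier radon_body = ?F"
    using frontier_polar_strip[OF compact_conj_data] by (simp add: radon_body_def)
  have minus: "- u \<in> ?F" if "u \<in> ?F" for u
    using that by (simp add: radon_body_def)
  have "G \<union> Conj_arc \<subseteq> ?F"
    using G_touching Conj_arc_touching by blast
  moreover have upper: "u \<in> G \<union> Conj_arc" if "u \<in> ?F" "0 \<le> snd u" for u
    using that touching_first_quadrant[of u] touching_second_quadrant[of u]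
    by (cases "0 \<le> fst u") auto
  have "u \<in> G \<union> Conj_arc \<union> uminus ` G \<union> uminus ` Conj_arc" if "u \<in> ?F" for u
  proof (cases "0 \<le> snd u")
    case True
    then show ?thesis
      using upper that by blast
  next
    case False
    then have "- u \<in> G \<union> Conj_arc"
      using upper[OF minus[OF that]] by simp
    then have "- (- u) \<in> uminus ` (G \<union> Conj_arc)"
      by (rule imageI)
    then show ?thesis
      by auto
  qed
  ultimately show ?thesis
    unfolding F using minus by blast
qed

lemma convex_body_radon_body: "convex_body radon_body"
  unfolding convex_body_def
proof (intro conjI)
  have "radon_body \<subseteq> {-1..1} \<times> {-1..1}"
    using radon_body_square by (force simp: mem_Times_iff abs_le_iff)
  then have "bounded radon_body"
    by (rule bounded_subset[rotated]) (simp add: bounded_Times)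
  then show "compact radon_body"
    using closed_polar_strip by (simp add: compact_eq_bounded_closed radon_body_def)
  show "convex radon_body"
    by (simp add: convex_polar_strip radon_body_def)
  have "0 \<in> interior radon_body"
    unfolding radon_body_def by (rule interior_polar_stripI[OF compact_conj_data]) (simp add: det2_def)
  then show "interior radon_body \<noteq> {}"
    by blast
qed

end

section \<open>The theorem in coordinates\<close>

lemma radon_curve_plane:
  fixes K :: "(real \<times> real) set"
  assumes g: "arc g" "pathstart g = (1, 0)" "pathfinish g = (0, 1)"
    and hull: "path_image g \<subseteq> convex hull {0, (1, 0), (0, 1), (1, 1)}"
    and K: "convex_body K"
      "frontier K = path_image g \<union> closed_segment 0 (1, 0) \<union> closed_segment 0 (0, 1)"
    and \<gamma>\<^sub>2: "\<gamma>\<^sub>2 = radon_gamma2 det2 (1, 0) (0, 1) (path_image g) ` {0..1}"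
  shows "\<exists>C. convex_body C \<and>
    frontier C = path_image g \<union> \<gamma>\<^sub>2 \<union> uminus ` path_image g \<union> uminus ` \<gamma>\<^sub>2"
proof -
  have "convex hull {0, (1, 0), (0, 1), (1, 1)} \<subseteq> {0..1::real} \<times> {0..1::real}"
    by (intro hull_minimal convex_Times convex_real_interval) (auto simp: zero_prod_def)
  then have sq: "0 \<le> fst x \<and> fst x \<le> 1 \<and> 0 \<le> snd x \<and> snd x \<le> 1" if "x \<in> path_image g" for x
    using hull that by (fastforce simp: mem_Times_iff)
  interpret corner_arc K g
  proof
    show "compact (path_image g)"
      using g(1) by (simp add: arc_imp_path compact_path_image)
    show "(1, 0) \<in> path_image g" "(0, 1) \<in> path_image g"
      using g pathstart_in_path_image pathfinish_in_path_image by metis+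
  qed (use assms sq in \<open>auto simp: convex_body_def\<close>)
  have "\<gamma>\<^sub>2 = Conj_arc"
    unfolding \<gamma>\<^sub>2 Conj_arc_def by (rule radon_gamma2_image) (use compact_G sq e1 e2 in auto)
  then show ?thesis
    using convex_body_radon_body frontier_radon_body by blast
qed

section \<open>Linear coordinates as homeomorphisms\<close>

lemma interior_homeomorphism_image:
  assumes "homeomorphism UNIV UNIV f g"
  shows "interior (f ` S) = f ` interior S"
proof -
  have sub: "h ` interior T \<subseteq> interior (h ` T)" if h: "homeomorphism UNIV UNIV h k"
    for h :: "'c::topological_space \<Rightarrow> 'd::topological_space" and k T
  proof (rule interior_maximal)
    \<comment> \<open>As a preimage under the continuous inverse, the image is open. Using this for
      both \<open>f\<close> and \<open>g\<close> gives equality.\<close>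
    have "h ` interior T = k -` interior T"
      using h by (force simp: homeomorphism_def)
    then show "open (h ` interior T)"
      using h by (simp add: homeomorphism_def open_vimage)
  qed (simp add: image_mono interior_subset)
  have "g ` interior (f ` S) \<subseteq> interior S"
    using sub[OF homeomorphism_symD[OF assms], of "f ` S"] assms
    by (simp add: homeomorphism_def image_image)
  then have "f ` g ` interior (f ` S) \<subseteq> f ` interior S"
    by (rule image_mono)
  moreover have "f ` g ` interior (f ` S) = interior (f ` S)"
    using assms by (simp add: homeomorphism_def image_image)
  ultimately show ?thesis
    using sub[OF assms, of S] by simp
qed

lemma frontier_homeomorphism_image:
  assumes "homeomorphism UNIV UNIV f g"
  shows "frontier (f ` S) = f ` frontier S"
proof -
  have "bij f"
    using assms by (intro bijI'[of f]) (metis homeomorphism_def UNIV_I, metis homeomorphism_def UNIV_I)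
  then show ?thesis
    unfolding frontier_interiors
    by (simp add: bij_image_Compl_eq[symmetric] interior_homeomorphism_image[OF assms]
        image_set_diff bij_is_inj)
qed

text \<open>An injective linear map is bounded below on the compact unit sphere of its Euclidean
  domain, which makes the inverse Lipschitz on the normed space.\<close>

lemma linear_homeomorphism_euclidean:
  fixes f :: "'a::euclidean_space \<Rightarrow> 'b::real_normed_vector"
  assumes f: "linear f" and gf: "\<And>x. g (f x) = x" and fg: "\<And>y. f (g y) = y"
  shows "homeomorphism UNIV UNIV f g"
proof -
  have cont: "continuous_on S f" for S
    using f by (simp add: linear_continuous_on linear_conv_bounded_linear)
  have "sphere (0 :: 'a) 1 \<noteq> {}"
    by simp
  moreover have "continuous_on (sphere 0 1) (\<lambda>x. norm (f x))"
    by (intro continuous_intros cont)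
  ultimately obtain x0 where x0: "x0 \<in> sphere 0 1"
    "\<And>x. x \<in> sphere 0 1 \<Longrightarrow> norm (f x0) \<le> norm (f x)"
    using continuous_attains_inf[OF compact_sphere] by blast
  have "f x0 \<noteq> 0"
  proof
    assume "f x0 = 0"
    then have "x0 = 0"
      using gf linear_0[OF f] by metis
    then show False
      using x0(1) by simp
  qed
  then have m: "norm (f x0) > 0"
    by simp
  have below: "norm (f x0) * norm x \<le> norm (f x)" for x
  proof (cases "x = 0")
    case False
    then have "norm (f x0) \<le> norm (f ((1 / norm x) *\<^sub>R x))"
      by (intro x0(2)) simp
    then show ?thesis
      using False by (simp add: linear_scale[OF f] field_simps)
  qed (simp add: linear_0[OF f])
  have "(1 / norm (f x0))-lipschitz_on UNIV g"
  proof (rule lipschitz_onI)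
    fix x y :: 'b
    show "dist (g x) (g y) \<le> 1 / norm (f x0) * dist x y"
      using below[of "g x - g y"] m
      by (simp add: dist_norm linear_diff[OF f] fg field_simps)
  qed simp
  then have "continuous_on UNIV g"
    by (rule lipschitz_on_continuous_on)
  then show ?thesis
    using cont gf fg by (auto simp: homeomorphism_def intro: image_eqI[of _ _ "g _"] image_eqI[of _ _ "f _"])
qed

lemma independent_pair_spans:
  fixes v w :: "'a::real_vector"
  assumes "dim (UNIV :: 'a set) = 2" "v \<noteq> w" "independent {v, w}"
  obtains a b where "x = a *\<^sub>R v + b *\<^sub>R w"
proof -
  obtain B :: "'a set" where B: "UNIV \<subseteq> span B" "card B = 2"
    using basis_exists[of UNIV] assms(1) by metis
  have "x \<in> span {v, w}"
  proof (rule ccontr)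
    assume x: "x \<notin> span {v, w}"
    then have "independent (insert x {v, w})"
      using assms(3) by (simp add: independent_insertI)
    \<comment> \<open>An infinite set has \<open>card\<close> 0, so \<open>card B = 2\<close> makes
      \<open>B\<close> finite, as the exchange bound requires.\<close>
    then have "card (insert x {v, w}) \<le> card B"
      using B independent_span_bound[of B "insert x {v, w}"] card.infinite[of B] by force
    moreover have "x \<noteq> v" "x \<noteq> w"
      using x by (auto simp: span_base)
    ultimately show False
      using assms(2) B(2) by simp
  qed
  then obtain a where "x - a *\<^sub>R v \<in> span {w}"
    by (auto simp: span_breakdown_eq)
  then obtain b where "x - a *\<^sub>R v = b *\<^sub>R w"
    by (auto simp: span_singleton)
  then have "x = a *\<^sub>R v + b *\<^sub>R w"
    by (simp add: algebra_simps)
  then show thesis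
    by (rule that)
qed

section \<open>Passage to a general two-dimensional space\<close>

theorem proposition3p1:
  fixes \<gamma> :: "'a::real_normed_vector set"
  assumes "dim (UNIV :: 'a set) = 2"
    and "radon_curve \<gamma>"
  shows "\<exists>K. convex_body K \<and> \<gamma> = frontier K"
proof -
  obtain v w :: 'a and \<omega> g \<gamma>\<^sub>1 \<gamma>\<^sub>2 K
    where vw: "v \<noteq> w" "independent {v, w}" and form: "symplectic_form \<omega>" "\<omega> v w = 1"
      and g: "arc g" "pathstart g = v" "pathfinish g = w" and \<gamma>\<^sub>1: "\<gamma>\<^sub>1 = path_image g"
      and hull: "\<gamma>\<^sub>1 \<subseteq> convex hull {0, v, w, v + w}"
      and K: "convex_body K" "frontier K = \<gamma>\<^sub>1 \<union> closed_segment 0 v \<union> closed_segment 0 w"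
      and \<gamma>\<^sub>2: "\<gamma>\<^sub>2 = radon_gamma2 \<omega> v w \<gamma>\<^sub>1 ` {0..1}"
      and \<gamma>: "\<gamma> = \<gamma>\<^sub>1 \<union> \<gamma>\<^sub>2 \<union> uminus ` \<gamma>\<^sub>1 \<union> uminus ` \<gamma>\<^sub>2"
    using assms(2) unfolding radon_curve_def by metis
  have bil: "bilinear \<omega>" and alt: "\<And>x. \<omega> x x = 0"
    using form by (auto simp: symplectic_form_def)
  note bs = bilinear_ladd[OF bil] bilinear_radd[OF bil] bilinear_lmul[OF bil] bilinear_rmul[OF bil]
  have wv: "\<omega> w v = - 1"
    using alt[of "v + w"] alt[of v] alt[of w] form(2) by (simp add: bs)
  define \<phi> where "\<phi> = (\<lambda>p :: real \<times> real. fst p *\<^sub>R v + snd p *\<^sub>R w)"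
  \<comment> \<open>Pairing with \<open>w\<close> and \<open>v\<close> reads off the coefficients of
    \<open>x\<close> in the basis \<open>v\<close>, \<open>w\<close>.\<close>
  define \<psi> where "\<psi> = (\<lambda>x. (\<omega> x w, \<omega> v x))"
  have lin: "linear \<phi>" "linear \<psi>"
    unfolding \<phi>_def \<psi>_def by (auto intro!: linearI simp: bs algebra_simps)
  have \<psi>\<phi>: "\<psi> (\<phi> p) = p" for p
    by (simp add: \<phi>_def \<psi>_def bs alt form(2))
  have \<phi>\<psi>: "\<phi> (\<psi> x) = x" for x
  proof -
    obtain a b where "x = \<phi> (a, b)"
      using independent_pair_spans[OF assms(1) vw] by (metis \<phi>_def fst_conv snd_conv)
    then show ?thesis
      by (simp add: \<psi>\<phi>)
  qed
  have hom: "homeomorphism UNIV UNIV \<phi> \<psi>"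
    by (rule linear_homeomorphism_euclidean[OF lin(1) \<psi>\<phi> \<phi>\<psi>])
  note hom' = homeomorphism_symD[OF hom]
  have cont: "continuous_on S \<phi>" "continuous_on T \<psi>" for S T
    using hom by (auto simp: homeomorphism_def intro: continuous_on_subset)
  have \<omega>: "\<omega> (\<phi> x) (\<phi> y) = det2 x y" for x y
    by (simp add: \<phi>_def det2_def bs alt form(2) wv)
  have \<psi>vw: "\<psi> v = (1, 0)" "\<psi> w = (0, 1)" "\<psi> 0 = 0"
    using linear_0[OF lin(2)] by (simp_all add: \<psi>_def alt form(2))
  have \<phi>12: "\<phi> (1, 0) = v" "\<phi> (0, 1) = w"
    by (simp_all add: \<phi>_def)
  define g' where "g' = \<psi> \<circ> g"
  have im: "path_image g' = \<psi> ` \<gamma>\<^sub>1" and im': "\<phi> ` path_image g' = \<gamma>\<^sub>1"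
    by (simp_all add: g'_def path_image_compose \<gamma>\<^sub>1 image_image \<phi>\<psi>)
  have "inj \<psi>"
    by (metis \<phi>\<psi> injI)
  then have g': "arc g'" "pathstart g' = (1, 0)" "pathfinish g' = (0, 1)"
    using g unfolding g'_def arc_def pathstart_compose pathfinish_compose
    by (auto intro: path_continuous_image cont comp_inj_on inj_on_subset simp: \<psi>vw)
  have "\<psi> ` (convex hull {0, v, w, v + w}) = convex hull {0, (1, 0), (0, 1), (1, 1)}"
    by (simp add: convex_hull_linear_image[OF lin(2)] linear_add[OF lin(2)] \<psi>vw)
  then have hull': "path_image g' \<subseteq> convex hull {0, (1, 0), (0, 1), (1, 1)}"
    using hull im by (metis image_mono)
  have body: "convex_body (\<psi> ` K)"
    using K(1) unfolding convex_body_def interior_homeomorphism_image[OF hom']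
    by (auto intro: compact_continuous_image cont convex_linear_image lin)
  have "frontier (\<psi> ` K) = path_image g' \<union> closed_segment 0 (1, 0) \<union> closed_segment 0 (0, 1)"
    unfolding frontier_homeomorphism_image[OF hom'] K(2) im image_Un
    by (simp add: closed_segment_linear_image[OF lin(2), symmetric] \<psi>vw)
  from radon_curve_plane[OF g' hull' body this refl] obtain C where C: "convex_body C"
    "frontier C = path_image g' \<union> radon_gamma2 det2 (1, 0) (0, 1) (path_image g') ` {0..1}
      \<union> uminus ` path_image g'
      \<union> uminus ` radon_gamma2 det2 (1, 0) (0, 1) (path_image g') ` {0..1}"
    by blast
  \<comment> \<open>\<open>\<phi>\<close> carries the determinant to \<open>\<omega>\<close>, so
    both suprema agree and the normalization commutes with \<open>\<phi>\<close>.\<close>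
  have "\<phi> (radon_gamma2 det2 (1, 0) (0, 1) (path_image g') t) = radon_gamma2 \<omega> v w \<gamma>\<^sub>1 t" for t
  proof -
    define y :: "real \<times> real" where "y = (1 - t) *\<^sub>R (0, 1) + t *\<^sub>R (- (1, 0))"
    have y: "\<phi> y = (1 - t) *\<^sub>R w + t *\<^sub>R (- v)"
      by (simp add: y_def \<phi>_def)
    have "(SUP x\<in>\<gamma>\<^sub>1. \<bar>\<omega> x (\<phi> y)\<bar>) = (SUP x\<in>path_image g'. \<bar>det2 x y\<bar>)"
      by (simp add: im'[symmetric] image_image \<omega>)
    then show ?thesis
      unfolding radon_gamma2_def Let_def y[symmetric] y_def[symmetric]
      by (simp add: linear_scale[OF lin(1)])
  qed
  then have \<gamma>\<^sub>2': "\<phi> ` radon_gamma2 det2 (1, 0) (0, 1) (path_image g') ` {0..1} = \<gamma>\<^sub>2"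
    by (simp add: image_image \<gamma>\<^sub>2)
  have uminus: "\<phi> ` uminus ` S = uminus ` \<phi> ` S" for S
    by (simp add: image_image linear_neg[OF lin(1)])
  have "frontier (\<phi> ` C) = \<gamma>"
    unfolding frontier_homeomorphism_image[OF hom] C(2) image_Un uminus im' \<gamma>\<^sub>2' \<gamma> by (rule refl)
  moreover have "convex_body (\<phi> ` C)"
    using C(1) unfolding convex_body_def interior_homeomorphism_image[OF hom]
    by (auto intro: compact_continuous_image cont convex_linear_image lin)
  ultimately show ?thesis
    by blast
qed

end
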